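(* Let $S = \langle r_1, \ldots, r_k\rangle$ be a numerical semigroup and let $w = (w_1,\ldots,w_k) \in \mathbb{Q}^k$. (a) If $\Delta_w(S) \ne \emptyset$, then $\Delta_w(S) \subset d\,\mathbb{Z}_{\ge 1}$, where $d = \min \Delta_w(S)$. (b) We have $\min \Delta_w(S) = \gcd(\{w_i r_j - w_j r_i : 1 \le i < j \le k\})$. (c) The set $\Delta_w(S)$ is finite. Moreover, $\max \Delta_w(S) = \max_{n \in \operatorname{Betti}(S)} \max \Delta_{S,w}(n)$.
   Context: A numerical semigroup $S = \langle r_1,\ldots,r_k\rangle$ is the additive subsemigroup $\{z_1 r_1 + \cdots + z_k r_k : z_i \in \mathbb{Z}_{\ge 0}\}$ of $\mathbb{Z}_{\ge 0}$ generated by positive integers $r_1,\ldots,r_k$; it is not required to have finite complement. The set of factorizations of $n \in S$ is $\mathsf{Z}(n) = \{z \in \mathbb{Z}_{\ge 0}^k : n = z_1 r_1 + \cdots + z_k r_k\}$. For $w \in \mathbb{Q}^k$ the weighted length of $z$ is $|z|_w = w_1 z_1 + \cdots + w_k z_k$, and $\mathsf{L}_{S,w}(n) = \{|z|_w : z \in \mathsf{Z}(n)\}$. Writing $\mathsf{L}_{S,w}(n) = \{\ell_1 < \cdots < \ell_m\}$, the weighted delta set of $n$ is $\Delta_{S,w}(n) = \{\ell_i - \ell_{i-1} : 2 \le i \le m\}$, and the weighted delta set of $S$ is $\Delta_w(S) = \bigcup_{n \in S} \Delta_{S,w}(n)$ (which may be empty). The factorization graph $\nabla_n$ of $n \in S$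 has vertex set $\mathsf{Z}(n)$, with $z, z'$ joined by an edge whenever they have at least one generator in common, that is, $z_i > 0$ and $z_i' > 0$ for some $i$. The element $n$ is a Betti element of $S$ if $\nabla_n$ is disconnected; $\operatorname{Betti}(S)$ is the set of Betti elements of $S$. The gcd of a finite set of rational numbers is the nonnegative generator of the (cyclic) subgroup of $\mathbb{Q}$ they generate. Conventions: $\min\emptyset = \max \emptyset = 0$ and $\gcd\emptyset = 0$.
   Formalization: Part (b) fails when the generators share a factor (S = ⟨2,4⟩, w = (1,1): min is 1, the gcd is 2); the formal version proves (b) when gcd(r_1,…,r_k) = 1 and, in general, gcd(r_1,…,r_k)·min Δ_w(S) = gcd({w_i r_j − w_j r_i}). *)

theory Defs
  imports Complex_Main "HOL-Computational_Algebra.Group_Closure"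
begin

text \<open>Tuples indexed by \<open>1, \<dots>, k\<close> are functions on \<^typ>\<open>nat\<close>, of which only the values on
  \<open>{1..k}\<close> matter. Factorizations are forced to vanish outside \<open>{1..k}\<close>, so that they correspond
  one-to-one to vectors in \<open>\<nat>\<^sup>k\<close>. The generators may have a common divisor \<open>> 1\<close>; this matters
  for the smallest element of the delta set: for generators \<open>2, 4\<close> and weights \<open>1, 1\<close> it is \<open>1\<close>,
  whereas \<open>w\<^sub>1 r\<^sub>2 - w\<^sub>2 r\<^sub>1 = 2\<close>.\<close>

definition semigroup_gen :: "nat \<Rightarrow> (nat \<Rightarrow> nat) \<Rightarrow> nat set" where
  "semigroup_gen k r = {n. \<exists>z :: nat \<Rightarrow> nat. n = (\<Sum>i=1..k. z i * r i)}"

definition factorizations :: "nat \<Rightarrow> (nat \<Rightarrow> nat) \<Rightarrow> nat \<Rightarrow> (nat \<Rightarrow> nat) set" where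
  "factorizations k r n = {z. (\<forall>i. i \<notin> {1..k} \<longrightarrow> z i = 0) \<and> n = (\<Sum>i=1..k. z i * r i)}"

definition weighted_length :: "nat \<Rightarrow> (nat \<Rightarrow> rat) \<Rightarrow> (nat \<Rightarrow> nat) \<Rightarrow> rat" where
  "weighted_length k w z = (\<Sum>i=1..k. w i * of_nat (z i))"

definition length_set :: "nat \<Rightarrow> (nat \<Rightarrow> nat) \<Rightarrow> (nat \<Rightarrow> rat) \<Rightarrow> nat \<Rightarrow> rat set" where
  "length_set k r w n = weighted_length k w ` factorizations k r n"

text \<open>\<^const>\<open>sorted_list_of_set\<close> is only meaningful on finite sets; length sets are finite
  as soon as the generators are positive (lemma \<open>finite_length_set\<close> below).\<close>

definition delta_set_elem :: "nat \<Rightarrow> (nat \<Rightarrow> nat) \<Rightarrow> (nat \<Rightarrow> rat) \<Rightarrow> nat \<Rightarrow> rat set" where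
  "delta_set_elem k r w n =
     (let l = sorted_list_of_set (length_set k r w n)
      in {l ! i - l ! (i - 1) | i. 1 \<le> i \<and> i < length l})"

definition delta_set :: "nat \<Rightarrow> (nat \<Rightarrow> nat) \<Rightarrow> (nat \<Rightarrow> rat) \<Rightarrow> rat set" where
  "delta_set k r w = (\<Union>n\<in>semigroup_gen k r. delta_set_elem k r w n)"

definition factorization_graph_edges ::
  "nat \<Rightarrow> (nat \<Rightarrow> nat) \<Rightarrow> nat \<Rightarrow> ((nat \<Rightarrow> nat) \<times> (nat \<Rightarrow> nat)) set" where
  "factorization_graph_edges k r n =
     {(z, z'). z \<in> factorizations k r n \<and> z' \<in> factorizations k r n \<and> z \<noteq> z' \<and>
               (\<exists>i\<in>{1..k}. z i > 0 \<and> z' i > 0)}"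

definition factorization_graph_connected :: "nat \<Rightarrow> (nat \<Rightarrow> nat) \<Rightarrow> nat \<Rightarrow> bool" where
  "factorization_graph_connected k r n \<longleftrightarrow>
     (\<forall>z\<in>factorizations k r n. \<forall>z'\<in>factorizations k r n.
        (z, z') \<in> (factorization_graph_edges k r n)\<^sup>*)"

definition betti :: "nat \<Rightarrow> (nat \<Rightarrow> nat) \<Rightarrow> nat set" where
  "betti k r = {n \<in> semigroup_gen k r. \<not> factorization_graph_connected k r n}"

text \<open>Well defined on finite sets: see \<open>rat_gcd_ex1\<close> below.\<close>

definition rat_gcd :: "rat set \<Rightarrow> rat" where
  "rat_gcd A = (THE g. g \<ge> 0 \<and> group_closure A = group_closure {g})"

definition min0 :: "rat set \<Rightarrow> rat" where
  "min0 A = (if A = {} then 0 else Min A)"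

definition max0 :: "rat set \<Rightarrow> rat" where
  "max0 A = (if A = {} then 0 else Max A)"


lemma finite_factorizations:
  assumes "\<And>i. i \<in> {1..k} \<Longrightarrow> r i > 0"
  shows "finite (factorizations k r n)"
proof (rule finite_subset)
  show "factorizations k r n \<subseteq>
      {z. \<forall>i. (i \<in> {1..k} \<longrightarrow> z i \<in> {0..n}) \<and> (i \<notin> {1..k} \<longrightarrow> z i = 0)}"
  proof safe
    fix z i assume z: "z \<in> factorizations k r n" and i: "i \<in> {1..k}"
    have "z i \<le> z i * r i"
      using assms[OF i] by simp
    also have "\<dots> \<le> (\<Sum>i=1..k. z i * r i)"
      using i by (intro member_le_sum) auto
    finally show "z i \<in> {0..n}"
      using z by (simp add: factorizations_def)
  qed (auto simp: factorizations_def)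
qed (rule finite_set_of_finite_funs; simp)

lemma finite_length_set:
  assumes "\<And>i. i \<in> {1..k} \<Longrightarrow> r i > 0"
  shows "finite (length_set k r w n)"
  using finite_factorizations[OF assms] by (simp add: length_set_def)

lemma group_closure_singleton_rat: "group_closure {g} = range (\<lambda>m. of_int m * g)" for g :: rat
proof -
  have "group_closure {1 :: rat} = range of_int"
  proof (intro equalityI subsetI)
    fix x :: rat assume "x \<in> group_closure {1}"
    then show "x \<in> range of_int"
    proof induction
      case (base s)
      then show ?case by (metis empty_iff insertE of_int_0 of_int_1 rangeI)
    next
      case (diff s t)
      then show ?case by (metis (no_types, lifting) imageE of_int_diff rangeI)
    qed
  next
    fix x :: rat assume "x \<in> range of_int"
    then obtain m where m: "x = of_int m" by auto
    have nat: "of_nat n \<in> group_closure {1 :: rat}" for n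
      using group_closure_scalar_mult_left[of 1 "{1}" n] group_closure.base[of "1::rat" "{1}"]
      by simp
    show "x \<in> group_closure {1}"
    proof (cases "m \<ge> 0")
      case True
      then show ?thesis using nat[of "nat m"] m by simp
    next
      case False
      then have "- x = of_nat (nat (- m))" using m by simp
      then show ?thesis using nat group_closure_minus_iff by metis
    qed
  qed
  then show ?thesis
    using group_closure_mult_all_eq[of g "{1}"] by (auto simp: mult.commute image_image)
qed

lemma rat_gcd_ex1:
  fixes A :: "rat set"
  assumes "finite A"
  shows "\<exists>!g. g \<ge> 0 \<and> group_closure A = group_closure {g}"
proof -
  have "\<exists>N::int. N > 0 \<and> (\<forall>a\<in>A. of_int N * a \<in> \<int>)"
    using assms
  proof induction
    case empty
    then show ?case by (auto intro: exI[of _ 1])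
  next
    case (insert a A)
    then obtain N :: int where N: "N > 0" "\<forall>a\<in>A. of_int N * a \<in> \<int>" by auto
    obtain p q where pq: "a = of_int p / of_int q" "q > 0"
      by (metis quotient_of_denom_pos quotient_of_div surj_pair)
    have "of_int (N * q) * a = of_int (N * p)" using pq by simp
    then have "of_int (N * q) * a \<in> \<int>" by (metis Ints_of_int)
    moreover have "of_int (N * q) * x \<in> \<int>" if "x \<in> A" for x
    proof -
      have "of_int (N * q) * x = of_int q * (of_int N * x)" by simp
      then show ?thesis using N(2) that by (metis Ints_mult Ints_of_int)
    qed
    ultimately show ?case using N(1) pq(2) by (intro exI[of _ "N * q"]) auto
  qed
  then obtain N :: int where N: "N > 0" "\<And>a. a \<in> A \<Longrightarrow> of_int N * a \<in> \<int>" by auto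
  define B where "B = (\<lambda>a. \<lfloor>of_int N * a\<rfloor>) ` A"
  have A: "A = (\<lambda>b. of_int b / of_int N) ` B"
    unfolding B_def image_image
  proof -
    have "of_int \<lfloor>of_int N * a\<rfloor> / of_int N = a" if "a \<in> A" for a
      using N(1) N(2)[OF that] by (auto elim!: Ints_cases simp: field_simps)
    then show "A = (\<lambda>a. of_int \<lfloor>of_int N * a\<rfloor> / of_int N) ` A" by simp
  qed
  have hom: "group_closure ((\<lambda>b. of_int b / of_int N) ` C)
      = (\<lambda>b. of_int b / (of_int N :: rat)) ` group_closure C" for C
  proof (intro equalityI subsetI)
    fix x :: rat assume "x \<in> group_closure ((\<lambda>b. of_int b / of_int N) ` C)"
    then show "x \<in> (\<lambda>b. of_int b / of_int N) ` group_closure C"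
    proof induction
      case (base s)
      then show ?case by (auto intro: group_closure.base image_eqI[of _ _ 0])
    next
      case (diff s t)
      then obtain b c where "s = of_int b / of_int N" "t = of_int c / of_int N"
        "b \<in> group_closure C" "c \<in> group_closure C" by auto
      then show ?case
        by (intro image_eqI[of _ _ "b - c"]) (auto simp: diff_divide_distrib intro: group_closure.diff)
    qed
  next
    fix x :: rat assume "x \<in> (\<lambda>b. of_int b / of_int N) ` group_closure C"
    then obtain b where "b \<in> group_closure C" "x = of_int b / of_int N" by auto
    then show "x \<in> group_closure ((\<lambda>b. of_int b / of_int N) ` C)"
    proof (induction arbitrary: x)
      case (base s)
      then show ?case by (auto intro: group_closure.base)
    next
      case (diff s t)
      then show ?case by (simp add: diff_divide_distrib group_closure.diff)
    qed
  qed
  have "group_closure B = group_closure {Gcd B}"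
    by (simp add: group_closure_eq)
  then have "group_closure A = group_closure {of_int (Gcd B) / of_int N}"
    using hom[of B] hom[of "{Gcd B}"] A by simp
  moreover have "of_int (Gcd B) / of_int N \<ge> (0 :: rat)"
    using N(1) by simp
  moreover have "g = h" if "g \<ge> 0" "h \<ge> 0" "group_closure {g} = group_closure {h}" for g h :: rat
  proof -
    have "g \<in> group_closure {h}" "h \<in> group_closure {g}"
      using that(3) group_closure.base[of g "{g}"] group_closure.base[of h "{h}"] by simp_all
    then have "g \<in> range (\<lambda>m. of_int m * h)" "h \<in> range (\<lambda>m. of_int m * g)"
      by (simp_all only: group_closure_singleton_rat)
    then obtain m n :: int where mn: "g = of_int m * h" "h = of_int n * g"
      by (elim rangeE)
    have le: "x \<le> y" if "x \<ge> 0" "y \<ge> 0" "y = of_int l * x" "y = 0 \<Longrightarrow> x = 0" for x y :: rat and l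
    proof (cases "y = 0")
      case False
      then have "of_int l > (0 :: rat)"
        using that(1-3) by (metis less_eq_rat_def mult_zero_right zero_less_mult_pos2)
      then have "1 \<le> l" by simp
      then have "1 * x \<le> of_int l * x"
        using that(1) by (intro mult_right_mono) auto
      then show ?thesis using that(3) by simp
    qed (use that in simp)
    have "g = 0 \<Longrightarrow> h = 0" using mn(2) by simp
    moreover have "h = 0 \<Longrightarrow> g = 0" using mn(1) by simp
    ultimately show ?thesis
      using le[of h g m] le[of g h n] that(1,2) mn by (metis order_antisym)
  qed
  ultimately show ?thesis
    by (intro ex1I[of _ "of_int (Gcd B) / of_int N"]) simp_all
qed

end

theory Submission
  imports Defs
begin

text \<open>The smallest gap is found by linear algebra over \<open>\<int>\<close>, the largest one by an induction along
  the factorization graphs.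

  Two factorizations of the same element differ by an integer relation
  \<open>u\<close> among the generators (\<open>\<Sum> u\<^sub>i r\<^sub>i = 0\<close>), and conversely every relation \<open>u = u\<^sup>+ - u\<^sup>-\<close> is such a
  difference. Hence the differences of lengths are exactly the values of \<open>w\<close> on the group of
  relations (\<open>relation_lengths\<close> below), a subgroup \<open>d \<int>\<close> of \<open>\<rat>\<close>. If \<open>d > 0\<close>, the two
  factorizations given by a relation of length \<open>d\<close> have consecutive lengths, because nothing smaller
  than \<open>d\<close> can occur; so \<open>d\<close> is the least gap and every gap is a multiple of it. By Bezout, the gcd
  \<open>G\<close> of the generators times any relation is an integer combination of the relations
  \<open>r\<^sub>j e\<^sub>i - r\<^sub>i e\<^sub>j\<close>, and these are themselves \<open>G\<close> times a relation; so the gcd of the numbers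
  \<open>w\<^sub>i r\<^sub>j - w\<^sub>j r\<^sub>i\<close> is \<open>G d\<close> (lemma \<open>cross_difference_group\<close>).

  For the largest gap, let \<open>B\<close> bound the gaps of all Betti elements. Then \<open>B\<close> bounds the gaps of
  every element \<open>n\<close>, by strong induction on \<open>n\<close> (lemma \<open>betti_bounds_gaps\<close>): if \<open>n\<close> is not a Betti
  element, then a path in its factorization graph leads across any threshold between two lengths of \<open>n\<close>,
  and so some edge of the path crosses the threshold. The two ends of this edge share a generator
  \<open>r\<^sub>i\<close>; removing it yields two factorizations of \<open>n - r\<^sub>i\<close>, to which the induction hypothesis
  applies. As gaps are multiples of \<open>d\<close> bounded by \<open>B\<close>, the delta set is finite. That a bound
  \<open>B\<close> exists at all follows from the finiteness of the set of Betti elements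
  (lemma \<open>betti_le_square\<close>).\<close>

section \<open>Gaps of finite sets of lengths\<close>

text \<open>An order-theoretic description of delta sets, free of list indices, on which all later
  arguments rest.\<close>

lemma consecutive_sorted_list_iff:
  fixes L :: "'a :: linorder set"
  assumes "finite L"
  defines "l \<equiv> sorted_list_of_set L"
  shows "(\<exists>i. 1 \<le> i \<and> i < length l \<and> x = l ! (i - 1) \<and> y = l ! i) \<longleftrightarrow>
    x \<in> L \<and> y \<in> L \<and> x < y \<and> (\<forall>z\<in>L. z \<le> x \<or> y \<le> z)"
proof -
  have sorted: "sorted_wrt (<) l" and set: "set l = L"
    using assms by simp_all
  note mono = sorted_nth_mono[OF strict_sorted_imp_sorted[OF sorted]]
  have "x \<in> L \<and> y \<in> L \<and> x < y \<and> (\<forall>z\<in>L. z \<le> x \<or> y \<le> z)"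
    if i: "1 \<le> i" "i < length l" "x = l ! (i - 1)" "y = l ! i" for i
  proof -
    have "z \<le> x \<or> y \<le> z" if z: "z \<in> L" for z
    proof -
      obtain j where j: "j < length l" "z = l ! j"
        using z set by (metis in_set_conv_nth)
      show ?thesis
      proof (cases "j \<le> i - 1")
        case True
        then show ?thesis using mono[of j "i - 1"] i j by simp
      next
        case False
        then show ?thesis using mono[of i j] i j by simp
      qed
    qed
    moreover have "x < y"
      using sorted_wrt_nth_less[OF sorted, of "i - 1" i] i by simp
    moreover have "x \<in> set l" "y \<in> set l"
      using i by simp_all
    ultimately show ?thesis
      using set by blast
  qed
  moreover have "\<exists>i. 1 \<le> i \<and> i < length l \<and> x = l ! (i - 1) \<and> y = l ! i"
    if x: "x \<in> L" and y: "y \<in> L" and "x < y" and gap: "\<forall>z\<in>L. z \<le> x \<or> y \<le> z"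
  proof -
    obtain a where a: "a < length l" "x = l ! a"
      using x set by (metis in_set_conv_nth)
    obtain b where b: "b < length l" "y = l ! b"
      using y set by (metis in_set_conv_nth)
    have "a < b"
      using \<open>x < y\<close> a b mono[of b a] by (meson not_le)
    moreover have "\<not> Suc a < b"
    proof
      assume less: "Suc a < b"
      then have "l ! Suc a \<in> L"
        using b set by (metis nth_mem order_less_trans)
      moreover have "x < l ! Suc a" "l ! Suc a < y"
        using sorted_wrt_nth_less[OF sorted] a b less by simp_all
      ultimately show False using gap by (meson not_le)
    qed
    ultimately have "b = Suc a" by simp
    then show ?thesis
      using a b by (intro exI[of _ b]) simp
  qed
  ultimately show ?thesis by blast
qed

lemma delta_set_elem_iff:
  assumes "\<forall>i\<in>{1..k}. r i > 0"
  shows "\<delta> \<in> delta_set_elem k r w n \<longleftrightarrow>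
    (\<exists>x\<in>length_set k r w n. \<exists>y\<in>length_set k r w n.
       x < y \<and> (\<forall>z\<in>length_set k r w n. z \<le> x \<or> y \<le> z) \<and> \<delta> = y - x)"
proof -
  let ?l = "sorted_list_of_set (length_set k r w n)"
  have fin: "finite (length_set k r w n)"
    using assms by (intro finite_length_set) simp
  have "\<delta> \<in> delta_set_elem k r w n \<longleftrightarrow>
      (\<exists>x y. (\<exists>i. 1 \<le> i \<and> i < length ?l \<and> x = ?l ! (i - 1) \<and> y = ?l ! i) \<and> \<delta> = y - x)"
    unfolding delta_set_elem_def Let_def by blast
  then show ?thesis
    unfolding consecutive_sorted_list_iff[OF fin] by blast
qed

lemma finite_delta_set_elem: "finite (delta_set_elem k r w n)"
proof -
  let ?l = "sorted_list_of_set (length_set k r w n)"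
  have "delta_set_elem k r w n \<subseteq> (\<lambda>i. ?l ! i - ?l ! (i - 1)) ` {..<length ?l}"
    by (auto simp: delta_set_elem_def Let_def)
  then show ?thesis
    by (rule finite_subset) simp
qed

text \<open>The bound is phrased by thresholds rather than by consecutive elements, so that a pair
  \<open>a\<close>, \<open>b\<close> found among the lengths of \<open>n - r\<^sub>i\<close> can be shifted by \<open>w\<^sub>i\<close> to the lengths of \<open>n\<close>,
  where the two need not be consecutive any more.\<close>

definition gaps_bounded :: "rat set \<Rightarrow> rat \<Rightarrow> bool" where
  "gaps_bounded L B \<longleftrightarrow>
     (\<forall>x\<in>L. \<forall>y\<in>L. \<forall>t. x \<le> t \<and> t < y \<longrightarrow> (\<exists>a\<in>L. \<exists>b\<in>L. a \<le> t \<and> t < b \<and> b - a \<le> B))"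

lemma gaps_bounded_length_set_iff:
  assumes "\<forall>i\<in>{1..k}. r i > 0"
  shows "gaps_bounded (length_set k r w n) B \<longleftrightarrow> (\<forall>\<delta>\<in>delta_set_elem k r w n. \<delta> \<le> B)"
proof
  assume gaps: "gaps_bounded (length_set k r w n) B"
  show "\<forall>\<delta>\<in>delta_set_elem k r w n. \<delta> \<le> B"
  proof
    fix \<delta> assume "\<delta> \<in> delta_set_elem k r w n"
    then obtain x y where xy: "x \<in> length_set k r w n" "y \<in> length_set k r w n" "x < y"
      "\<forall>z\<in>length_set k r w n. z \<le> x \<or> y \<le> z" "\<delta> = y - x"
      using delta_set_elem_iff[OF assms] by blast
    then obtain a b where "b \<in> length_set k r w n" "a \<le> x" "x < b" "b - a \<le> B"
      using gaps unfolding gaps_bounded_def by blast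
    then show "\<delta> \<le> B" using xy(4,5) by force
  qed
next
  let ?L = "length_set k r w n"
  assume delta: "\<forall>\<delta>\<in>delta_set_elem k r w n. \<delta> \<le> B"
  have fin: "finite ?L"
    using assms by (intro finite_length_set) simp
  show "gaps_bounded ?L B"
    unfolding gaps_bounded_def
  proof (intro ballI allI impI)
    fix x y t assume xy: "x \<in> ?L" "y \<in> ?L" "x \<le> t \<and> t < y"
    define a where "a = Max {a \<in> ?L. a \<le> t}"
    define b where "b = Min {b \<in> ?L. t < b}"
    have a: "a \<in> {a \<in> ?L. a \<le> t}"
      unfolding a_def using fin xy by (intro Max_in) auto
    have b: "b \<in> {b \<in> ?L. t < b}"
      unfolding b_def using fin xy by (intro Min_in) auto
    have "z \<le> a \<or> b \<le> z" if "z \<in> ?L" for z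
      unfolding a_def b_def using fin that by (cases "z \<le> t") auto
    then have "b - a \<in> delta_set_elem k r w n"
      unfolding delta_set_elem_iff[OF assms] using a b
      by (intro bexI[of _ a] bexI[of _ b]) auto
    then show "\<exists>a\<in>?L. \<exists>b\<in>?L. a \<le> t \<and> t < b \<and> b - a \<le> B"
      using delta a b by blast
  qed
qed

section \<open>Betti elements\<close>

text \<open>Let \<open>z\<close>, \<open>z'\<close> be factorizations in different components and let \<open>z'\<close> use \<open>r\<^sub>j\<close>. If \<open>z\<close> had
  more than \<open>r\<^sub>j\<close> copies of some \<open>r\<^sub>i\<close>, then trading \<open>r\<^sub>j\<close> of them for \<open>r\<^sub>i\<close> copies of \<open>r\<^sub>j\<close> would
  give a factorization that still uses \<open>r\<^sub>i\<close>, like \<open>z\<close>, and also \<open>r\<^sub>j\<close>, like \<open>z'\<close>, so that \<open>z\<close>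
  and \<open>z'\<close> would be connected through it. So the coordinates of \<open>z\<close> are bounded,
  and with them the Betti element.\<close>

lemma betti_le_square:
  assumes pos: "\<forall>i\<in>{1..k}. r i > 0" and n: "n \<in> betti k r"
  shows "n \<le> (\<Sum>i=1..k. r i)\<^sup>2"
proof -
  let ?E = "factorization_graph_edges k r n"
  obtain z z' where z: "z \<in> factorizations k r n" and z': "z' \<in> factorizations k r n"
    and sep: "(z, z') \<notin> ?E\<^sup>*"
    using n unfolding betti_def factorization_graph_connected_def by blast
  have zn: "n = (\<Sum>i=1..k. z i * r i)" and z'n: "n = (\<Sum>i=1..k. z' i * r i)"
    and z0: "\<And>i. i \<notin> {1..k} \<Longrightarrow> z i = 0"
    using z z' by (auto simp: factorizations_def)
  show ?thesis
  proof (cases "\<exists>j\<in>{1..k}. z' j > 0")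
    case False
    then have "n = 0" using z'n by simp
    then show ?thesis by simp
  next
    case True
    then obtain j where j: "j \<in> {1..k}" "z' j > 0" by blast
    have bound: "z i \<le> r j" if i: "i \<in> {1..k}" for i
    proof (rule ccontr)
      assume "\<not> z i \<le> r j"
      then have more: "r j < z i" by simp
      have "i \<noteq> j"
      proof
        assume "i = j"
        then have "\<exists>l\<in>{1..k}. z l > 0 \<and> z' l > 0"
          using j more by (intro bexI[of _ j]) auto
        then have "z = z' \<or> (z, z') \<in> ?E"
          using z z' by (auto simp: factorization_graph_edges_def)
        then show False using sep by auto
      qed
      define y where "y = (\<lambda>l. if l = i then z i - r j else if l = j then z j + r i else z l)"
      have split: "(\<Sum>l=1..k. f l) = f i + (f j + (\<Sum>l\<in>{1..k} - {i} - {j}. f l))"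
        for f :: "nat \<Rightarrow> nat"
        using i j \<open>i \<noteq> j\<close> by (simp add: sum.remove[of _ i] sum.remove[of _ j])
      have "(\<Sum>l\<in>{1..k} - {i} - {j}. y l * r l) = (\<Sum>l\<in>{1..k} - {i} - {j}. z l * r l)"
        by (rule sum.cong) (auto simp: y_def)
      moreover have "(z i - r j) * r i + (z j + r i) * r j = z i * r i + z j * r j"
      proof -
        obtain c where "z i = r j + c"
          using more by (metis less_imp_add_positive)
        then show ?thesis by (simp add: algebra_simps)
      qed
      ultimately have "(\<Sum>l=1..k. y l * r l) = n"
        unfolding zn split[of "\<lambda>l. y l * r l"] split[of "\<lambda>l. z l * r l"]
        using \<open>i \<noteq> j\<close> by (simp add: y_def)
      then have y: "y \<in> factorizations k r n"
        using z0 i j by (auto simp: factorizations_def y_def)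
      have yi: "y i > 0" and yj: "y j > 0"
        using more pos i j \<open>i \<noteq> j\<close> by (auto simp: y_def)
      have "r j > 0"
        using pos j by blast
      then have "y i \<noteq> z i"
        using more by (simp add: y_def)
      then have "z \<noteq> y" by auto
      then have "(z, y) \<in> ?E"
        using z y yi more i by (auto simp: factorization_graph_edges_def intro!: bexI[of _ i])
      moreover have "y = z' \<or> (y, z') \<in> ?E"
        using z' y yj j by (auto simp: factorization_graph_edges_def)
      ultimately show False
        using sep by (metis r_into_rtrancl rtrancl.rtrancl_into_rtrancl)
    qed
    have "n \<le> (\<Sum>i=1..k. r j * r i)"
      unfolding zn using bound by (intro sum_mono mult_right_mono) auto
    also have "\<dots> = r j * (\<Sum>i=1..k. r i)"
      by (simp add: sum_distrib_left)
    also have "\<dots> \<le> (\<Sum>i=1..k. r i) * (\<Sum>i=1..k. r i)"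
      using j by (intro mult_right_mono member_le_sum) auto
    finally show ?thesis by (simp add: power2_eq_square)
  qed
qed

lemma finite_betti:
  assumes "\<forall>i\<in>{1..k}. r i > 0"
  shows "finite (betti k r)"
proof (rule finite_subset)
  show "betti k r \<subseteq> {..(\<Sum>i=1..k. r i)\<^sup>2}"
    using betti_le_square[OF assms] by auto
qed simp

section \<open>Betti elements govern the largest gap\<close>

lemma rtrancl_crosses_threshold:
  fixes f :: "'a \<Rightarrow> 'b :: linorder"
  assumes "(x, y) \<in> E\<^sup>*" "f x \<le> t" "t < f y"
  shows "\<exists>p q. (p, q) \<in> E \<and> f p \<le> t \<and> t < f q"
  using assms
proof (induction rule: rtrancl_induct)
  case (step y z)
  then show ?case by (cases "f y \<le> t") auto
qed simp

text \<open>Stated for an arbitrary commutative ring in order to serve both for weighted lengths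
  (\<open>f = w\<close>) and for the factored element itself (\<open>f = r\<close>, over the integers, where subtraction is
  not truncated).\<close>

lemma sum_fun_upd_pred:
  fixes f :: "nat \<Rightarrow> 'a :: comm_ring_1"
  assumes "i \<in> {1..k}" "z i > 0"
  shows "(\<Sum>l=1..k. f l * of_nat ((z(i := z i - 1)) l)) = (\<Sum>l=1..k. f l * of_nat (z l)) - f i"
proof -
  have "(\<Sum>l\<in>{1..k} - {i}. f l * of_nat ((z(i := z i - 1)) l)) =
      (\<Sum>l\<in>{1..k} - {i}. f l * of_nat (z l))"
    by (rule sum.cong) auto
  then show ?thesis
    using assms by (simp add: sum.remove[of _ i] of_nat_diff algebra_simps)
qed

lemma factorization_remove_generator:
  assumes z: "z \<in> factorizations k r n" and i: "i \<in> {1..k}" "z i > 0"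
  shows "z(i := z i - 1) \<in> factorizations k r (n - r i)" (is ?fact)
    and "weighted_length k w (z(i := z i - 1)) = weighted_length k w z - w i" (is ?len)
    and "r i \<le> n"
proof -
  show ?len
    unfolding weighted_length_def using sum_fun_upd_pred[of i k z w] i by simp
  have n: "n = (\<Sum>l=1..k. z l * r l)"
    using z by (simp add: factorizations_def)
  have "r i \<le> z i * r i"
    using i by simp
  also have "\<dots> \<le> n"
    unfolding n using i by (intro member_le_sum) auto
  finally show le: "r i \<le> n" .
  have "int (\<Sum>l=1..k. (z(i := z i - 1)) l * r l) = int n - int (r i)"
    using sum_fun_upd_pred[of i k z "\<lambda>l. int (r l)"] i unfolding n
    by (simp add: mult.commute)
  then have "(\<Sum>l=1..k. (z(i := z i - 1)) l * r l) = n - r i"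
    using le by linarith
  then show ?fact
    using z i by (auto simp: factorizations_def)
qed

lemma length_add_generator:
  assumes x: "x \<in> length_set k r w (n - r i)" and i: "i \<in> {1..k}" "r i \<le> n"
  shows "x + w i \<in> length_set k r w n"
proof -
  obtain z where z: "z \<in> factorizations k r (n - r i)" "x = weighted_length k w z"
    using x by (auto simp: length_set_def)
  let ?y = "z(i := Suc (z i))"
  have shift: "?y(i := ?y i - 1) = z" by simp
  have "int (\<Sum>l=1..k. ?y l * r l) = int (\<Sum>l=1..k. z l * r l) + int (r i)"
    using sum_fun_upd_pred[of i k ?y "\<lambda>l. int (r l)"] i unfolding shift
    by (simp add: mult.commute)
  also have "(\<Sum>l=1..k. z l * r l) = n - r i"
    using z by (simp add: factorizations_def)
  also have "int (n - r i) + int (r i) = int n"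
    using i by simp
  finally have "n = (\<Sum>l=1..k. ?y l * r l)" by linarith
  then have "?y \<in> factorizations k r n"
    using z i by (auto simp: factorizations_def)
  moreover have "weighted_length k w ?y = x + w i"
    using sum_fun_upd_pred[of i k ?y w] i z unfolding shift by (simp add: weighted_length_def)
  ultimately show ?thesis
    unfolding length_set_def by force
qed

text \<open>The ends of an edge that crosses the threshold \<open>t\<close> share some \<open>r\<^sub>i\<close>; without it, they are
  factorizations of \<open>n - r\<^sub>i\<close> whose lengths lie on the two sides of \<open>t - w\<^sub>i\<close>.\<close>

lemma betti_bounds_gaps:
  assumes pos: "\<forall>i\<in>{1..k}. r i > 0"
    and betti: "\<And>n. n \<in> betti k r \<Longrightarrow> gaps_bounded (length_set k r w n) B"
  shows "gaps_bounded (length_set k r w n) B"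
proof (induction n rule: less_induct)
  case (less n)
  let ?L = "length_set k r w"
  show ?case
    unfolding gaps_bounded_def
  proof (intro ballI allI impI)
    fix x y t assume x: "x \<in> ?L n" and y: "y \<in> ?L n" and t: "x \<le> t \<and> t < y"
    show "\<exists>a\<in>?L n. \<exists>b\<in>?L n. a \<le> t \<and> t < b \<and> b - a \<le> B"
    proof (cases "n \<in> betti k r")
      case True
      then show ?thesis
        using betti x y t unfolding gaps_bounded_def by blast
    next
      case False
      obtain z z' where z: "z \<in> factorizations k r n" "x = weighted_length k w z"
        and z': "z' \<in> factorizations k r n" "y = weighted_length k w z'"
        using x y by (auto simp: length_set_def)
      have "n \<in> semigroup_gen k r"
        using z by (auto simp: semigroup_gen_def factorizations_def)
      then have "(z, z') \<in> (factorization_graph_edges k r n)\<^sup>*"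
        using False z z' by (auto simp: betti_def factorization_graph_connected_def)
      then obtain p q where pq: "(p, q) \<in> factorization_graph_edges k r n"
        "weighted_length k w p \<le> t" "t < weighted_length k w q"
        using rtrancl_crosses_threshold[of z z' _ "weighted_length k w" t] z z' t by blast
      then obtain i where i: "i \<in> {1..k}" "p i > 0" "q i > 0"
        and p: "p \<in> factorizations k r n" and q: "q \<in> factorizations k r n"
        by (auto simp: factorization_graph_edges_def)
      note p' = factorization_remove_generator[OF p i(1,2)]
      note q' = factorization_remove_generator[OF q i(1,3)]
      have "weighted_length k w p - w i \<in> ?L (n - r i)" "weighted_length k w q - w i \<in> ?L (n - r i)"
        unfolding length_set_def using p' q' by (metis imageI)+
      moreover have "n - r i < n"
        using pos i p'(3) by (metis diff_less order_less_le_trans)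
      ultimately obtain a b where ab: "a \<in> ?L (n - r i)" "b \<in> ?L (n - r i)"
        "a \<le> t - w i" "t - w i < b" "b - a \<le> B"
        using less.IH[of "n - r i"] pq(2,3) unfolding gaps_bounded_def
        by (meson diff_right_mono diff_strict_right_mono)
      then have "a + w i \<in> ?L n" "b + w i \<in> ?L n"
        using length_add_generator i p'(3) by blast+
      moreover have "a + w i \<le> t" "t < b + w i" "(b + w i) - (a + w i) \<le> B"
        using ab by linarith+
      ultimately show ?thesis by blast
    qed
  qed
qed

section \<open>Lengths of relations and the smallest gap\<close>

definition relation_lengths :: "nat \<Rightarrow> (nat \<Rightarrow> nat) \<Rightarrow> (nat \<Rightarrow> rat) \<Rightarrow> rat set" where
  "relation_lengths k r w =
     {\<Sum>i=1..k. w i * of_int (u i) | u :: nat \<Rightarrow> int. (\<Sum>i=1..k. u i * int (r i)) = 0}"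

lemma relation_lengths_diff:
  assumes "x \<in> relation_lengths k r w" "y \<in> relation_lengths k r w"
  shows "x - y \<in> relation_lengths k r w"
proof -
  obtain u v :: "nat \<Rightarrow> int"
    where u: "x = (\<Sum>i=1..k. w i * of_int (u i))" "(\<Sum>i=1..k. u i * int (r i)) = 0"
      and v: "y = (\<Sum>i=1..k. w i * of_int (v i))" "(\<Sum>i=1..k. v i * int (r i)) = 0"
    using assms by (auto simp: relation_lengths_def)
  have "x - y = (\<Sum>i=1..k. w i * of_int (u i - v i))"
    using u v by (simp add: sum_subtractf algebra_simps)
  moreover have "(\<Sum>i=1..k. (u i - v i) * int (r i)) = 0"
    using u v by (simp add: sum_subtractf algebra_simps)
  ultimately show ?thesis
    unfolding relation_lengths_def by (auto intro!: exI[of _ "\<lambda>i. u i - v i"])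
qed

lemma length_set_diff:
  assumes "x \<in> length_set k r w n" "y \<in> length_set k r w n"
  shows "y - x \<in> relation_lengths k r w"
proof -
  obtain z z' where z: "z \<in> factorizations k r n" "x = weighted_length k w z"
    and z': "z' \<in> factorizations k r n" "y = weighted_length k w z'"
    using assms by (auto simp: length_set_def)
  define u where "u i = int (z' i) - int (z i)" for i
  have "int (\<Sum>i=1..k. z' i * r i) = int (\<Sum>i=1..k. z i * r i)"
    using z z' by (simp add: factorizations_def)
  then have "(\<Sum>i=1..k. u i * int (r i)) = 0"
    by (simp add: u_def sum_subtractf algebra_simps)
  moreover have "y - x = (\<Sum>i=1..k. w i * of_int (u i))"
    using z z' by (simp add: weighted_length_def u_def sum_subtractf algebra_simps)
  ultimately show ?thesis
    unfolding relation_lengths_def by blast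
qed

text \<open>Splitting a relation into its positive and negative part.\<close>

lemma relation_length_realized:
  assumes "d \<in> relation_lengths k r w"
  obtains n x where "n \<in> semigroup_gen k r" "x \<in> length_set k r w n" "x + d \<in> length_set k r w n"
proof -
  obtain u :: "nat \<Rightarrow> int" where d: "d = (\<Sum>i=1..k. w i * of_int (u i))"
    and u: "(\<Sum>i=1..k. u i * int (r i)) = 0"
    using assms by (auto simp: relation_lengths_def)
  define z where "z i = (if i \<in> {1..k} then nat (u i) else 0)" for i
  define z' where "z' i = (if i \<in> {1..k} then nat (- u i) else 0)" for i
  define n where "n = (\<Sum>i=1..k. z' i * r i)"
  have zz': "int (z i) = int (z' i) + u i" if "i \<in> {1..k}" for i
    using that by (simp add: z_def z'_def)
  have "int (\<Sum>i=1..k. z i * r i) = (\<Sum>i=1..k. (int (z' i) + u i) * int (r i))"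
    using zz' by simp
  also have "\<dots> = int n"
    using u by (simp add: n_def sum.distrib algebra_simps)
  finally have "n = (\<Sum>i=1..k. z i * r i)"
    by linarith
  then have z: "z \<in> factorizations k r n" and z': "z' \<in> factorizations k r n"
    by (auto simp: factorizations_def n_def z_def z'_def)
  have "weighted_length k w z = (\<Sum>i=1..k. w i * of_int (int (z i)))"
    by (simp add: weighted_length_def)
  also have "\<dots> = (\<Sum>i=1..k. w i * of_int (int (z' i) + u i))"
    using zz' by (intro sum.cong) auto
  also have "\<dots> = weighted_length k w z' + d"
    by (simp add: weighted_length_def d sum.distrib algebra_simps)
  finally have "weighted_length k w z' + d \<in> length_set k r w n"
    using z by (metis imageI length_set_def)
  moreover have "weighted_length k w z' \<in> length_set k r w n"
    using z' by (simp add: length_set_def)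
  moreover have "n \<in> semigroup_gen k r"
    by (auto simp: semigroup_gen_def n_def)
  ultimately show thesis using that by blast
qed

definition cross_differences :: "nat \<Rightarrow> (nat \<Rightarrow> nat) \<Rightarrow> (nat \<Rightarrow> rat) \<Rightarrow> rat set" where
  "cross_differences k r w =
     {w i * of_nat (r j) - w j * of_nat (r i) | i j. 1 \<le> i \<and> i < j \<and> j \<le> k}"

lemma finite_cross_differences: "finite (cross_differences k r w)"
proof (rule finite_subset)
  show "cross_differences k r w \<subseteq>
      (\<lambda>(i, j). w i * of_nat (r j) - w j * of_nat (r i)) ` ({1..k} \<times> {1..k})"
    by (force simp: cross_differences_def)
qed simp

lemma group_closure_of_int_mult:
  fixes x :: "'a :: comm_ring_1"
  assumes "x \<in> group_closure S"
  shows "of_int m * x \<in> group_closure S"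
proof (cases m rule: int_cases2)
  case (nonneg n)
  then show ?thesis using group_closure_scalar_mult_left[OF assms, of n] by simp
next
  case (nonpos n)
  then show ?thesis using group_closure_scalar_mult_left[OF assms, of n] by simp
qed

lemma group_closure_sum_family:
  assumes "\<And>i. i \<in> I \<Longrightarrow> f i \<in> group_closure S"
  shows "(\<Sum>i\<in>I. f i) \<in> group_closure S"
  using assms by (induction I rule: infinite_finite_induct) (auto intro: group_closure_add)

lemma bezout_family:
  fixes r :: "'i \<Rightarrow> nat"
  assumes "finite I"
  obtains c :: "'i \<Rightarrow> int" where "(\<Sum>i\<in>I. c i * int (r i)) = int (Gcd (r ` I))"
proof -
  have "\<exists>c. (\<Sum>i\<in>I. c i * int (r i)) = x" if "x \<in> group_closure (int ` r ` I)" for x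
    using that
  proof induction
    case (base s)
    show ?case
    proof (cases "s = 0")
      case True
      then show ?thesis by (intro exI[of _ "\<lambda>_. 0"]) simp
    next
      case False
      then obtain j where "j \<in> I" "s = int (r j)" using base by auto
      then show ?thesis
        using assms by (intro exI[of _ "\<lambda>i. if i = j then 1 else 0"])
          (simp add: if_distrib[of "\<lambda>x. x * _"] cong: if_cong)
    qed
  next
    case (diff s t)
    then obtain c c' where "(\<Sum>i\<in>I. c i * int (r i)) = s" "(\<Sum>i\<in>I. c' i * int (r i)) = t"
      by blast
    then show ?case
      by (intro exI[of _ "\<lambda>i. c i - c' i"]) (simp add: sum_subtractf algebra_simps)
  qed
  from this[OF Gcd_in_group_closure] show thesis
    using that by (auto simp: Gcd_int_eq)
qed

text \<open>With \<open>G = \<Sum> c\<^sub>j r\<^sub>j\<close>, a relation \<open>u\<close> satisfies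
  \<open>G u = \<Sum>\<^sub>i \<Sum>\<^sub>j u\<^sub>i c\<^sub>j (r\<^sub>j e\<^sub>i - r\<^sub>i e\<^sub>j)\<close>, because the subtracted part is
  \<open>(\<Sum> u\<^sub>i r\<^sub>i) (\<Sum> c\<^sub>j e\<^sub>j) = 0\<close>. In the other direction, \<open>r\<^sub>j e\<^sub>i - r\<^sub>i e\<^sub>j\<close> divided by \<open>G\<close> is still an
  integer relation.\<close>

lemma cross_difference_group:
  "group_closure (cross_differences k r w) =
     (*) (of_nat (Gcd (r ` {1..k}))) ` relation_lengths k r w"
proof (intro equalityI subsetI)
  let ?G = "Gcd (r ` {1..k})"
  fix x assume "x \<in> group_closure (cross_differences k r w)"
  then show "x \<in> (*) (of_nat ?G) ` relation_lengths k r w"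
  proof induction
    case (base s)
    show ?case
    proof (cases "s = 0")
      case True
      have "0 \<in> relation_lengths k r w"
        unfolding relation_lengths_def by (auto intro!: exI[of _ "\<lambda>_. 0"])
      then show ?thesis using True by force
    next
      case False
      then obtain i j where ij: "1 \<le> i" "i < j" "j \<le> k"
        and s: "s = w i * of_nat (r j) - w j * of_nat (r i)"
        using base by (auto simp: cross_differences_def)
      have "?G dvd r i" "?G dvd r j"
        using ij by (auto intro!: Gcd_dvd)
      then obtain a b where ab: "r i = ?G * a" "r j = ?G * b"
        by (auto elim!: dvdE)
      define u :: "nat \<Rightarrow> int" where "u l = (if l = i then int b else 0) - (if l = j then int a else 0)" for l
      have i: "i \<in> {1..k}" and j: "j \<in> {1..k}" using ij by auto
      have "(\<Sum>l=1..k. u l * int (r l)) = int b * int (r i) - int a * int (r j)"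
        using i j by (simp add: u_def left_diff_distrib sum_subtractf if_distrib[of "\<lambda>x. x * _"] cong: if_cong)
      also have "\<dots> = 0"
        unfolding ab(1) ab(2) by simp
      finally have "(\<Sum>l=1..k. w l * of_int (u l)) \<in> relation_lengths k r w"
        unfolding relation_lengths_def by blast
      moreover have "(\<Sum>l=1..k. w l * of_int (u l)) = w i * of_nat b - w j * of_nat a"
        using i j by (simp add: u_def right_diff_distrib sum_subtractf if_distrib[of "of_int"]
            if_distrib[of "\<lambda>x. _ * x"] cong: if_cong)
      moreover have "s = of_nat ?G * (w i * of_nat b - w j * of_nat a)"
        unfolding s ab(1) ab(2) by (simp add: algebra_simps)
      ultimately show ?thesis by auto
    qed
  next
    case (diff s t)
    then obtain a b where "s = of_nat ?G * a" "t = of_nat ?G * b"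
      "a \<in> relation_lengths k r w" "b \<in> relation_lengths k r w" by auto
    then show ?case
      using relation_lengths_diff[of a k r w b]
      by (auto simp: right_diff_distrib[symmetric])
  qed
next
  let ?G = "Gcd (r ` {1..k})"
  let ?X = "cross_differences k r w"
  fix x assume "x \<in> (*) (of_nat ?G) ` relation_lengths k r w"
  then obtain u :: "nat \<Rightarrow> int"
    where x: "x = of_nat ?G * (\<Sum>i=1..k. w i * of_int (u i))"
      and u: "(\<Sum>i=1..k. u i * int (r i)) = 0"
    by (auto simp: relation_lengths_def)
  obtain c :: "nat \<Rightarrow> int" where c: "(\<Sum>j=1..k. c j * int (r j)) = int ?G"
    using bezout_family[of "{1..k}" r] by auto
  have u': "(\<Sum>i=1..k. of_int (u i) * of_nat (r i)) = (0 :: rat)"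
    using arg_cong[OF u, of "of_int :: int \<Rightarrow> rat"] by simp
  have c': "(of_nat ?G :: rat) = (\<Sum>j=1..k. of_int (c j) * of_nat (r j))"
    using arg_cong[OF c, of "of_int :: int \<Rightarrow> rat"] by simp
  have cross: "w i * of_nat (r j) - w j * of_nat (r i) \<in> group_closure ?X"
    if "i \<in> {1..k}" "j \<in> {1..k}" for i j
  proof (cases i j rule: linorder_cases)
    case less
    then show ?thesis
      using that by (intro group_closure.base) (auto simp: cross_differences_def)
  next
    case equal
    then show ?thesis by simp
  next
    case greater
    then have "w j * of_nat (r i) - w i * of_nat (r j) \<in> group_closure ?X"
      using that by (intro group_closure.base) (auto simp: cross_differences_def)
    then show ?thesis
      using group_closure_minus_iff by (metis minus_diff_eq)
  qed
  have "x = (\<Sum>i=1..k. \<Sum>j=1..k. (w i * of_int (u i)) * (of_int (c j) * of_nat (r j)))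
      - (\<Sum>i=1..k. of_int (u i) * of_nat (r i)) * (\<Sum>j=1..k. of_int (c j) * w j)"
    unfolding x u' c' by (simp add: sum_product mult.commute)
  also have "\<dots> = (\<Sum>i=1..k. \<Sum>j=1..k.
      of_int (u i * c j) * (w i * of_nat (r j) - w j * of_nat (r i)))"
    unfolding sum_product by (simp add: sum_subtractf[symmetric] algebra_simps)
  also have "\<dots> \<in> group_closure ?X"
    using cross by (intro group_closure_sum_family group_closure_of_int_mult)
  finally show "x \<in> group_closure ?X" .
qed

lemma rat_gcd_group:
  assumes "finite A"
  shows "rat_gcd A \<ge> 0" "group_closure A = range (\<lambda>m. of_int m * rat_gcd A)"
  using theI'[OF rat_gcd_ex1[OF assms]] unfolding rat_gcd_def[symmetric]
  by (simp_all add: group_closure_singleton_rat)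

lemma relation_lengths_cyclic:
  assumes pos: "\<forall>i\<in>{1..k}. r i > 0"
  obtains d where "d \<ge> 0" "relation_lengths k r w = range (\<lambda>m. of_int m * d)"
    "of_nat (Gcd (r ` {1..k})) * d = rat_gcd (cross_differences k r w)"
proof (cases "k = 0")
  \<comment> \<open>Without generators their gcd is \<open>0\<close>, and dividing by it is impossible.\<close>
  case True
  then have "relation_lengths k r w = {0}"
    by (auto simp: relation_lengths_def)
  moreover have "rat_gcd (cross_differences k r w) = 0"
  proof -
    have "rat_gcd (cross_differences k r w) \<in> range (\<lambda>m. of_int m * rat_gcd (cross_differences k r w))"
      by (rule range_eqI[of _ _ 1]) simp
    also have "\<dots> = {0}"
      using rat_gcd_group(2)[OF finite_cross_differences, of k r w] True
      by (simp add: cross_differences_def)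
    finally show ?thesis by simp
  qed
  ultimately show ?thesis using True that[of 0] by auto
next
  case False
  define G :: rat where "G = of_nat (Gcd (r ` {1..k}))"
  define g where "g = rat_gcd (cross_differences k r w)"
  have "Gcd (r ` {1..k}) dvd r 1" "r 1 > 0"
    using False pos by (auto intro!: Gcd_dvd)
  then have G: "G > 0"
    unfolding G_def by (metis dvd_0_left gr0I of_nat_0_less_iff)
  have "(*) G ` relation_lengths k r w = range (\<lambda>m. of_int m * g)"
    using cross_difference_group rat_gcd_group(2)[OF finite_cross_differences]
    unfolding G_def g_def by metis
  then have "(\<lambda>x. x / G) ` (*) G ` relation_lengths k r w = range (\<lambda>m. of_int m * (g / G))"
    by (simp add: image_image)
  then have "relation_lengths k r w = range (\<lambda>m. of_int m * (g / G))"
    using G by (simp add: image_image)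
  moreover have "g / G \<ge> 0"
    using G rat_gcd_group(1)[OF finite_cross_differences] by (simp add: g_def)
  moreover have "G * (g / G) = g"
    using G by simp
  ultimately show ?thesis
    using that unfolding G_def g_def by blast
qed

lemma delta_set_positive_multiples:
  assumes pos: "\<forall>i\<in>{1..k}. r i > 0"
    and d: "d \<ge> 0" "relation_lengths k r w = range (\<lambda>m. of_int m * d)"
    and \<delta>: "\<delta> \<in> delta_set k r w"
  shows "d > 0" "\<exists>m::nat. m \<ge> 1 \<and> \<delta> = d * of_nat m"
proof -
  obtain n x y where xy: "x \<in> length_set k r w n" "y \<in> length_set k r w n" "x < y" "\<delta> = y - x"
    using \<delta> delta_set_elem_iff[OF pos] unfolding delta_set_def by blast
  then have "\<delta> \<in> relation_lengths k r w" "\<delta> > 0"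
    using length_set_diff by auto
  then obtain m where m: "\<delta> = of_int m * d" "of_int m * d > 0"
    using d(2) by auto
  then show "d > 0"
    using d(1) by (cases "d = 0") auto
  then have "m > 0"
    using m(2) by (simp add: zero_less_mult_iff)
  then show "\<exists>m::nat. m \<ge> 1 \<and> \<delta> = d * of_nat m"
    using m(1) by (intro exI[of _ "nat m"]) simp
qed

text \<open>Two factorizations whose lengths differ by \<open>d\<close> have consecutive lengths, since no length
  difference lies strictly between \<open>0\<close> and \<open>d\<close>.\<close>

lemma relation_generator_in_delta_set:
  assumes pos: "\<forall>i\<in>{1..k}. r i > 0"
    and d: "d > 0" "relation_lengths k r w = range (\<lambda>m. of_int m * d)"
  shows "d \<in> delta_set k r w"
proof -
  have "d \<in> relation_lengths k r w"
    unfolding d(2) by (rule range_eqI[of _ _ 1]) simp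
  then obtain n x where n: "n \<in> semigroup_gen k r"
    and x: "x \<in> length_set k r w n" "x + d \<in> length_set k r w n"
    by (rule relation_length_realized)
  have "z \<le> x \<or> x + d \<le> z" if z: "z \<in> length_set k r w n" for z
  proof -
    obtain m where m: "z - x = of_int m * d"
      using length_set_diff[OF x(1) z] d(2) by auto
    show ?thesis
    proof (cases "m \<le> 0")
      case True
      then have "of_int m * d \<le> 0"
        using d(1) by (simp add: mult_le_0_iff)
      then show ?thesis using m by simp
    next
      case False
      then have "1 * d \<le> of_int m * d"
        using d(1) by (intro mult_right_mono) auto
      then show ?thesis using m by simp
    qed
  qed
  then have "d \<in> delta_set_elem k r w n"
    unfolding delta_set_elem_iff[OF pos] using x d(1)
    by (intro bexI[of _ x] bexI[of _ "x + d"]) auto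
  then show ?thesis
    using n by (auto simp: delta_set_def)
qed

section \<open>Extreme values of the delta set\<close>

lemma max0_ge: "finite A \<Longrightarrow> a \<in> A \<Longrightarrow> a \<le> max0 A"
  by (auto simp: max0_def)

lemma max0_in: "finite A \<Longrightarrow> A \<noteq> {} \<Longrightarrow> max0 A \<in> A"
  by (simp add: max0_def)

lemma delta_set_le_betti_max:
  assumes pos: "\<forall>i\<in>{1..k}. r i > 0" and \<delta>: "\<delta> \<in> delta_set k r w"
  shows "\<delta> \<le> max0 ((\<lambda>n. max0 (delta_set_elem k r w n)) ` betti k r)" (is "_ \<le> ?B")
proof -
  have "gaps_bounded (length_set k r w n) ?B" if n: "n \<in> betti k r" for n
    unfolding gaps_bounded_length_set_iff[OF pos]
  proof
    fix \<epsilon> assume "\<epsilon> \<in> delta_set_elem k r w n"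
    then have "\<epsilon> \<le> max0 (delta_set_elem k r w n)"
      by (rule max0_ge[OF finite_delta_set_elem])
    also have "\<dots> \<le> ?B"
      using n finite_betti[OF pos] by (intro max0_ge) auto
    finally show "\<epsilon> \<le> ?B" .
  qed
  then have "gaps_bounded (length_set k r w n) ?B" for n
    by (rule betti_bounds_gaps[OF pos])
  then show ?thesis
    using \<delta> gaps_bounded_length_set_iff[OF pos] unfolding delta_set_def by blast
qed

lemma finite_delta_set:
  assumes pos: "\<forall>i\<in>{1..k}. r i > 0"
  shows "finite (delta_set k r w)"
proof (cases "delta_set k r w = {}")
  case False
  obtain d where d: "d \<ge> 0" "relation_lengths k r w = range (\<lambda>m. of_int m * d)"
    by (rule relation_lengths_cyclic[OF pos])
  have "d > 0"
    using False delta_set_positive_multiples(1)[OF pos d] by blast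
  obtain M where M: "\<And>\<delta>. \<delta> \<in> delta_set k r w \<Longrightarrow> \<delta> \<le> M"
    using delta_set_le_betti_max[OF pos] by blast
  have "delta_set k r w \<subseteq> (\<lambda>m. d * of_nat m) ` {..nat \<lceil>M / d\<rceil>}"
  proof
    fix \<delta> assume \<delta>: "\<delta> \<in> delta_set k r w"
    then obtain m :: nat where m: "\<delta> = d * of_nat m"
      using delta_set_positive_multiples(2)[OF pos d] by blast
    then have "of_nat m \<le> M / d"
      using M[OF \<delta>] \<open>d > 0\<close> by (simp add: field_simps)
    then have "m \<le> nat \<lceil>M / d\<rceil>"
      by linarith
    then show "\<delta> \<in> (\<lambda>m. d * of_nat m) ` {..nat \<lceil>M / d\<rceil>}"
      using m by blast
  qed
  then show ?thesis
    by (rule finite_subset) simp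
qed simp

lemma min_delta_set:
  assumes pos: "\<forall>i\<in>{1..k}. r i > 0"
    and d: "d \<ge> 0" "relation_lengths k r w = range (\<lambda>m. of_int m * d)"
  shows "min0 (delta_set k r w) = d"
proof (cases "d = 0")
  case True
  then have "delta_set k r w = {}"
    using delta_set_positive_multiples(1)[OF pos d] by blast
  then show ?thesis using True by (simp add: min0_def)
next
  case False
  then have "d > 0" using d(1) by simp
  then have "d \<in> delta_set k r w"
    using relation_generator_in_delta_set[OF pos _ d(2)] by blast
  moreover have "d \<le> \<delta>" if \<delta>: "\<delta> \<in> delta_set k r w" for \<delta>
  proof -
    obtain m :: nat where "m \<ge> 1" "\<delta> = d * of_nat m"
      using delta_set_positive_multiples(2)[OF pos d \<delta>] by blast
    then show ?thesis using \<open>d > 0\<close> by simp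
  qed
  ultimately show ?thesis
    using finite_delta_set[OF pos] by (auto simp: min0_def intro!: Min_eqI)
qed

lemma max_delta_set:
  assumes pos: "\<forall>i\<in>{1..k}. r i > 0"
  shows "max0 (delta_set k r w) = max0 ((\<lambda>n. max0 (delta_set_elem k r w n)) ` betti k r)"
    (is "_ = max0 ?M")
proof (cases "delta_set k r w = {}")
  case True
  have "delta_set_elem k r w n = {}" if "n \<in> betti k r" for n
    using True that by (auto simp: delta_set_def betti_def)
  then have "?M \<subseteq> {0}"
    by (auto simp: max0_def)
  then have "?M = {} \<or> ?M = {0}"
    by (rule subset_singletonD)
  then have "max0 ?M = 0"
    unfolding max0_def[of ?M] by (elim disjE) simp_all
  then show ?thesis
    using True by (simp add: max0_def)
next
  case False
  then obtain \<delta> where \<delta>: "\<delta> \<in> delta_set k r w" by blast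
  then have "\<delta> > 0"
    using delta_set_elem_iff[OF pos] by (auto simp: delta_set_def)
  \<comment> \<open>Positivity of the maximum excludes the default value \<open>0\<close>, so it is attained by a gap.\<close>
  then have "max0 ?M > 0"
    using delta_set_le_betti_max[OF pos \<delta>] by simp
  then have "?M \<noteq> {}"
    by (auto simp: max0_def)
  then have "max0 ?M \<in> ?M"
    using finite_betti[OF pos] by (intro max0_in) auto
  then obtain n where n: "n \<in> betti k r" "max0 ?M = max0 (delta_set_elem k r w n)"
    by blast
  then have "delta_set_elem k r w n \<noteq> {}"
    using \<open>max0 ?M > 0\<close> by (auto simp: max0_def)
  then have "max0 ?M \<in> delta_set_elem k r w n"
    unfolding n(2) by (rule max0_in[OF finite_delta_set_elem])
  then have "max0 ?M \<in> delta_set k r w"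
    using n(1) by (auto simp: delta_set_def betti_def)
  then show ?thesis
    using False finite_delta_set[OF pos] delta_set_le_betti_max[OF pos]
    by (auto simp: max0_def[of "delta_set k r w"] intro!: Max_eqI)
qed

theorem theorem3p12:
  fixes k :: nat and r :: "nat \<Rightarrow> nat" and w :: "nat \<Rightarrow> rat"
  assumes "\<forall>i\<in>{1..k}. r i > 0"
  shows "(delta_set k r w \<noteq> {} \<longrightarrow>
            delta_set k r w \<subseteq> {min0 (delta_set k r w) * of_nat m | m :: nat. m \<ge> 1})
       \<and> (Gcd (r ` {1..k}) = 1 \<longrightarrow>
            min0 (delta_set k r w) =
              rat_gcd {w i * of_nat (r j) - w j * of_nat (r i) | i j. 1 \<le> i \<and> i < j \<and> j \<le> k})
       \<and> of_nat (Gcd (r ` {1..k})) * min0 (delta_set k r w) =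
            rat_gcd {w i * of_nat (r j) - w j * of_nat (r i) | i j. 1 \<le> i \<and> i < j \<and> j \<le> k}
       \<and> finite (delta_set k r w)
       \<and> max0 (delta_set k r w) = max0 ((\<lambda>n. max0 (delta_set_elem k r w n)) ` betti k r)"
proof -
  obtain d where d: "d \<ge> 0" "relation_lengths k r w = range (\<lambda>m. of_int m * d)"
    and gcd: "of_nat (Gcd (r ` {1..k})) * d = rat_gcd (cross_differences k r w)"
    by (rule relation_lengths_cyclic[OF assms])
  have min: "min0 (delta_set k r w) = d"
    by (rule min_delta_set[OF assms d])
  have "delta_set k r w \<subseteq> {d * of_nat m | m :: nat. m \<ge> 1}"
    using delta_set_positive_multiples(2)[OF assms d] by blast
  moreover have "d = rat_gcd (cross_differences k r w)" if "Gcd (r ` {1..k}) = 1"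
    using gcd unfolding that by simp
  ultimately show ?thesis
    unfolding min cross_differences_def[symmetric]
    using gcd finite_delta_set[OF assms] max_delta_set[OF assms] by blast
qed

end
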